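(* Let $\mathcal{X}$ be a p-adic Hilbert space and let $T:\mathcal{X}\to\mathcal{X}$ be a magic contraction, with associated self-adjoint bounded linear operators $M_T, M_{T^*}:\mathcal{X}\to\mathcal{X}$ (satisfying $M_T^2=I_\mathcal{X}-T^*T$, $M_{T^*}^2=I_\mathcal{X}-TT^*$, $TM_T=M_{T^*}T$). Then the operator $$U:=\begin{pmatrix} T & M_{T^*}\\ M_T & -T^*\end{pmatrix}$$ is unitary on $\mathcal{X}\oplus\mathcal{X}$, and $$T=P_\mathcal{X}U|_\mathcal{X},\qquad T^*=P_\mathcal{X}U^*|_\mathcal{X},$$ where $P_\mathcal{X}:\mathcal{X}\oplus\mathcal{X}\ni(x,y)\mapsto x\in\mathcal{X}$ and $|_\mathcal{X}$ denotes restriction to $\mathcal{X}$ embedded as the first summand, $x\mapsto(x,0)$.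
   Context: p-adic Hilbert space: Let $\mathbb{K}$ be a complete non-Archimedean valued field with valuation $|\cdot|$, and let $\mathcal{X}$ be a non-Archimedean Banach space over $\mathbb{K}$ with norm $\|\cdot\|$. $\mathcal{X}$ is a p-adic Hilbert space if there is a map (inner product) $\langle\cdot,\cdot\rangle:\mathcal{X}\times\mathcal{X}\to\mathbb{K}$ such that (i) if $\langle x,y\rangle=0$ for all $y\in\mathcal{X}$ then $x=0$; (ii) $\langle x,y\rangle=\langle y,x\rangle$ for all $x,y$; (iii) $\langle\alpha x+y,z\rangle=\alpha\langle x,z\rangle+\langle y,z\rangle$ for all $\alpha\in\mathbb{K}$ and $x,y,z\in\mathcal{X}$; (iv) $|\langle x,y\rangle|\le\|x\|\|y\|$ for all $x,y$. Operators: a bounded linear operator $T:\mathcal{X}\to\mathcal{X}$ is adjointable if there is a bounded linear operator $T^*:\mathcal{X}\to\mathcal{X}$ with $\langle Tx,y\rangle=\langle x,T^*y\rangle$ for all $x,y\in\mathcal{X}$ (it is then unique). An adjointable $T$ is self-adjoint if $T^*=T$; an adjointable $U$ is unitary if $UU^*=U^*U=I_\mathcal{X}$, the identity operator on $\mathcal{X}$. Magic contraction: a bounded linear adjointable operator $T:\mathcal{X}\to\mathcal{X}$ is a magic contraction if there are self-adjoint bounded linear operators $M_T, M_{T^*}:\mathcal{X}\to\mathcal{X}$ (not necessarily unique) such that $M_T^2=I_\mathcal{X}-T^*T$, $M_{T^*}^2=I_\mathcal{X}-TT^*$ and $TM_T=M_{T^*}T$. The direct sum $\mathcal{X}\oplus\mathcal{X}$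 is a p-adic Hilbert space with norm $\|(x,y)\|=\max\{\|x\|,\|y\|\}$ and inner product $\langle(x,y),(x',y')\rangle=\langle x,x'\rangle+\langle y,y'\rangle$; operator matrices act on column vectors. *)

theory Defs
  imports "HOL-Analysis.Abstract_Metric_Spaces" "HOL-Analysis.Product_Vector"
begin

text \<open>
  The scalars form an arbitrary type of class \<open>field\<close> with an explicit valuation \<open>absv\<close>, because the
  normed type classes of the library presuppose real scalars.  The trivial valuation is not excluded.
\<close>

locale nonarch_valued_field =
  fixes absv :: "'k::field \<Rightarrow> real"
  assumes absv_nonneg: "0 \<le> absv a"
    and absv_eq_0_iff: "absv a = 0 \<longleftrightarrow> a = 0"
    and absv_mult: "absv (a * b) = absv a * absv b"
    and absv_ultrametric: "absv (a + b) \<le> max (absv a) (absv b)"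

locale complete_nonarch_valued_field = nonarch_valued_field absv
  for absv :: "'k::field \<Rightarrow> real" +
  assumes absv_complete: "Metric_space.mcomplete UNIV (\<lambda>a b. absv (a - b))"

locale nonarch_normed_space = nonarch_valued_field absv + vector_space scl
  for absv :: "'k::field \<Rightarrow> real" and scl :: "'k \<Rightarrow> 'x::ab_group_add \<Rightarrow> 'x" +
  fixes nrm :: "'x \<Rightarrow> real"
  assumes nrm_nonneg: "0 \<le> nrm x"
    and nrm_eq_0_iff: "nrm x = 0 \<longleftrightarrow> x = 0"
    and nrm_scale: "nrm (scl a x) = absv a * nrm x"
    and nrm_ultrametric: "nrm (x + y) \<le> max (nrm x) (nrm y)"
begin

lemma nrm_minus: "nrm (- x) = nrm x"
proof -
  have "absv 1 = 1"
    using absv_mult[of 1 1] absv_eq_0_iff[of 1] by simp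
  moreover have "absv (- 1) * absv (- 1) = absv 1"
    by (simp flip: absv_mult)
  ultimately have "absv (- 1) = 1"
    using absv_nonneg[of "- 1"] by (simp add: square_eq_1_iff)
  then show ?thesis
    using nrm_scale[of "- 1" x] by simp
qed

lemma nrm_metric: "Metric_space UNIV (\<lambda>x y. nrm (x - y))"
proof
  fix x y z :: 'x
  show "0 \<le> nrm (x - y)" by (rule nrm_nonneg)
  show "nrm (x - y) = nrm (y - x)" using nrm_minus[of "x - y"] by simp
  show "nrm (x - y) = 0 \<longleftrightarrow> x = y" by (simp add: nrm_eq_0_iff)
  show "nrm (x - z) \<le> nrm (x - y) + nrm (y - z)"
    using nrm_ultrametric[of "x - y" "y - z"] nrm_nonneg[of "x - y"] nrm_nonneg[of "y - z"]
    by simp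
qed

end

locale nonarch_banach_space =
  complete_nonarch_valued_field absv + nonarch_normed_space absv scl nrm
  for absv :: "'k::field \<Rightarrow> real" and scl :: "'k \<Rightarrow> 'x::ab_group_add \<Rightarrow> 'x"
    and nrm :: "'x \<Rightarrow> real" +
  assumes nrm_complete: "Metric_space.mcomplete UNIV (\<lambda>x y. nrm (x - y))"

locale padic_hilbert_space = nonarch_banach_space absv scl nrm
  for absv :: "'k::field \<Rightarrow> real" and scl :: "'k \<Rightarrow> 'x::ab_group_add \<Rightarrow> 'x"
    and nrm :: "'x \<Rightarrow> real" +
  fixes ip :: "'x \<Rightarrow> 'x \<Rightarrow> 'k"
  assumes ip_nondegenerate: "(\<forall>y. ip x y = 0) \<Longrightarrow> x = 0"
    and ip_commute: "ip x y = ip y x"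
    and ip_linear: "ip (scl a x + y) z = a * ip x z + ip y z"
    and ip_bound: "absv (ip x y) \<le> nrm x * nrm y"


definition bounded_operator ::
    "('k::field \<Rightarrow> 'x::ab_group_add \<Rightarrow> 'x) \<Rightarrow> ('x \<Rightarrow> real) \<Rightarrow> ('x \<Rightarrow> 'x) \<Rightarrow> bool" where
  "bounded_operator scl nrm T \<longleftrightarrow>
     Vector_Spaces.linear scl scl T \<and> (\<exists>C. \<forall>x. nrm (T x) \<le> C * nrm x)"

definition is_adjoint ::
    "('k::field \<Rightarrow> 'x::ab_group_add \<Rightarrow> 'x) \<Rightarrow> ('x \<Rightarrow> real) \<Rightarrow> ('x \<Rightarrow> 'x \<Rightarrow> 'k) \<Rightarrow>
      ('x \<Rightarrow> 'x) \<Rightarrow> ('x \<Rightarrow> 'x) \<Rightarrow> bool" where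
  "is_adjoint scl nrm ip T S \<longleftrightarrow>
     bounded_operator scl nrm S \<and> (\<forall>x y. ip (T x) y = ip x (S y))"

definition adjointable ::
    "('k::field \<Rightarrow> 'x::ab_group_add \<Rightarrow> 'x) \<Rightarrow> ('x \<Rightarrow> real) \<Rightarrow> ('x \<Rightarrow> 'x \<Rightarrow> 'k) \<Rightarrow>
      ('x \<Rightarrow> 'x) \<Rightarrow> bool" where
  "adjointable scl nrm ip T \<longleftrightarrow>
     bounded_operator scl nrm T \<and> (\<exists>S. is_adjoint scl nrm ip T S)"

text \<open>Meaningful for adjointable operators only; see \<open>adjoint_op_eq\<close> below.\<close>

definition adjoint_op ::
    "('k::field \<Rightarrow> 'x::ab_group_add \<Rightarrow> 'x) \<Rightarrow> ('x \<Rightarrow> real) \<Rightarrow> ('x \<Rightarrow> 'x \<Rightarrow> 'k) \<Rightarrow>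
      ('x \<Rightarrow> 'x) \<Rightarrow> ('x \<Rightarrow> 'x)" where
  "adjoint_op scl nrm ip T = (THE S. is_adjoint scl nrm ip T S)"

definition self_adjoint ::
    "('k::field \<Rightarrow> 'x::ab_group_add \<Rightarrow> 'x) \<Rightarrow> ('x \<Rightarrow> real) \<Rightarrow> ('x \<Rightarrow> 'x \<Rightarrow> 'k) \<Rightarrow>
      ('x \<Rightarrow> 'x) \<Rightarrow> bool" where
  "self_adjoint scl nrm ip T \<longleftrightarrow>
     adjointable scl nrm ip T \<and> adjoint_op scl nrm ip T = T"

definition unitary ::
    "('k::field \<Rightarrow> 'x::ab_group_add \<Rightarrow> 'x) \<Rightarrow> ('x \<Rightarrow> real) \<Rightarrow> ('x \<Rightarrow> 'x \<Rightarrow> 'k) \<Rightarrow>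
      ('x \<Rightarrow> 'x) \<Rightarrow> bool" where
  "unitary scl nrm ip U \<longleftrightarrow>
     adjointable scl nrm ip U \<and>
     U \<circ> adjoint_op scl nrm ip U = id \<and> adjoint_op scl nrm ip U \<circ> U = id"

text \<open>\<open>M\<close> and \<open>N\<close> play the roles of $M_T$ and $M_{T^*}$.\<close>

definition magic_operators ::
    "('k::field \<Rightarrow> 'x::ab_group_add \<Rightarrow> 'x) \<Rightarrow> ('x \<Rightarrow> real) \<Rightarrow> ('x \<Rightarrow> 'x \<Rightarrow> 'k) \<Rightarrow>
      ('x \<Rightarrow> 'x) \<Rightarrow> ('x \<Rightarrow> 'x) \<Rightarrow> ('x \<Rightarrow> 'x) \<Rightarrow> bool" where
  "magic_operators scl nrm ip T M N \<longleftrightarrow>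
     self_adjoint scl nrm ip M \<and> self_adjoint scl nrm ip N \<and>
     M \<circ> M = (\<lambda>x. x - adjoint_op scl nrm ip T (T x)) \<and>
     N \<circ> N = (\<lambda>x. x - T (adjoint_op scl nrm ip T x)) \<and>
     T \<circ> M = N \<circ> T"

definition magic_contraction ::
    "('k::field \<Rightarrow> 'x::ab_group_add \<Rightarrow> 'x) \<Rightarrow> ('x \<Rightarrow> real) \<Rightarrow> ('x \<Rightarrow> 'x \<Rightarrow> 'k) \<Rightarrow>
      ('x \<Rightarrow> 'x) \<Rightarrow> bool" where
  "magic_contraction scl nrm ip T \<longleftrightarrow>
     adjointable scl nrm ip T \<and> (\<exists>M N. magic_operators scl nrm ip T M N)"

lemma (in padic_hilbert_space) adjoint_op_eq:
  assumes "is_adjoint scl nrm ip T S"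
  shows "adjoint_op scl nrm ip T = S"
  unfolding adjoint_op_def
proof (rule the_equality)
  fix S' assume S': "is_adjoint scl nrm ip T S'"
  have "S' y = S y" for y
  proof -
    have "ip (S' y - S y) x = 0" for x
    proof -
      have "ip (S' y) x = ip (S y) x"
        using assms S' ip_commute unfolding is_adjoint_def by metis
      then show ?thesis
        using ip_linear[of "- 1" "S y" "S' y" x] by simp
    qed
    then show ?thesis using ip_nondegenerate[of "S' y - S y"] by simp
  qed
  then show "S' = S" ..
qed (fact assms)


abbreviation sum_scale ::
    "('k::field \<Rightarrow> 'x::ab_group_add \<Rightarrow> 'x) \<Rightarrow> 'k \<Rightarrow> 'x \<times> 'x \<Rightarrow> 'x \<times> 'x" where
  "sum_scale scl \<equiv> module_prod.scale scl scl"

definition sum_nrm :: "('x \<Rightarrow> real) \<Rightarrow> 'x \<times> 'x \<Rightarrow> real" where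
  "sum_nrm nrm = (\<lambda>(x, y). max (nrm x) (nrm y))"

definition sum_ip :: "('x \<Rightarrow> 'x \<Rightarrow> 'k::field) \<Rightarrow> 'x \<times> 'x \<Rightarrow> 'x \<times> 'x \<Rightarrow> 'k" where
  "sum_ip ip = (\<lambda>(x, y) (x', y'). ip x x' + ip y y')"

text \<open>Row-major entries, acting on column vectors.\<close>

definition op_matrix ::
    "('x \<Rightarrow> 'x) \<Rightarrow> ('x \<Rightarrow> 'x) \<Rightarrow> ('x \<Rightarrow> 'x) \<Rightarrow> ('x \<Rightarrow> 'x) \<Rightarrow>
      'x::ab_group_add \<times> 'x \<Rightarrow> 'x \<times> 'x" where
  "op_matrix A B C D = (\<lambda>(x, y). (A x + B y, C x + D y))"

lemma (in padic_hilbert_space) direct_sum: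
  "padic_hilbert_space absv (sum_scale scl) (sum_nrm nrm) (sum_ip ip)"
proof -
  interpret vp: vector_space_prod scl scl ..
  interpret n: nonarch_normed_space absv "sum_scale scl" "sum_nrm nrm"
  proof
    fix a and x y :: "'x \<times> 'x"
    show "0 \<le> sum_nrm nrm x"
      by (simp add: sum_nrm_def split_beta nrm_nonneg le_max_iff_disj)
    show "sum_nrm nrm x = 0 \<longleftrightarrow> x = 0"
      using nrm_nonneg[of "fst x"] nrm_nonneg[of "snd x"] nrm_eq_0_iff[of "fst x"]
        nrm_eq_0_iff[of "snd x"]
      by (auto simp: sum_nrm_def split_beta prod_eq_iff max_def split: if_splits)
    show "sum_nrm nrm (sum_scale scl a x) = absv a * sum_nrm nrm x"
      by (simp add: sum_nrm_def split_beta vp.scale_def nrm_scale max_mult_distrib_left absv_nonneg)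
    show "sum_nrm nrm (x + y) \<le> max (sum_nrm nrm x) (sum_nrm nrm y)"
      using nrm_ultrametric[of "fst x" "fst y"] nrm_ultrametric[of "snd x" "snd y"]
      by (auto simp: sum_nrm_def split_beta)
  qed
  interpret m: Metric_space UNIV "\<lambda>x y. nrm (x - y)" by (rule nrm_metric)
  interpret mp: Metric_space UNIV "\<lambda>x y. sum_nrm nrm (x - y)" by (rule n.nrm_metric)
  have "mp.mcomplete"
    unfolding mp.mcomplete_def
  proof (intro allI impI)
    fix s :: "nat \<Rightarrow> 'x \<times> 'x" assume s: "mp.MCauchy s"
    have "m.MCauchy (\<lambda>n. fst (s n))" "m.MCauchy (\<lambda>n. snd (s n))"
      using s unfolding mp.MCauchy_def m.MCauchy_def
      by (simp_all add: sum_nrm_def split_beta) meson+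
    then obtain x y where
      "limitin m.mtopology (\<lambda>n. fst (s n)) x sequentially"
      "limitin m.mtopology (\<lambda>n. snd (s n)) y sequentially"
      using nrm_complete unfolding m.mcomplete_def by blast
    then have "limitin mp.mtopology s (x, y) sequentially"
      unfolding m.limitin_metric mp.limitin_metric
      by (auto simp: sum_nrm_def split_beta eventually_conj_iff)
    then show "\<exists>z. limitin mp.mtopology s z sequentially" ..
  qed
  moreover have ip0: "ip 0 y = 0" for y
    using ip_linear[of "- 1" 0 0 y] by simp
  ultimately show ?thesis
  proof unfold_locales
    fix a and x y z :: "'x \<times> 'x"
    show "x = 0" if "\<forall>y. sum_ip ip x y = 0"
    proof -
      have "ip (fst x) w = 0" "ip (snd x) w = 0" for w
        using that[rule_format, of "(w, 0)"] that[rule_format, of "(0, w)"]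
          ip0 ip_commute[of _ 0] by (auto simp: sum_ip_def split_beta)
      then show ?thesis
        using ip_nondegenerate by (simp add: prod_eq_iff)
    qed
    show "sum_ip ip x y = sum_ip ip y x"
      by (simp add: sum_ip_def split_beta ip_commute)
    show "sum_ip ip (sum_scale scl a x + y) z = a * sum_ip ip x z + sum_ip ip y z"
      by (simp add: sum_ip_def split_beta vp.scale_def ip_linear distrib_left)
    have "absv (ip (fst x) (fst y)) \<le> sum_nrm nrm x * sum_nrm nrm y"
      by (rule order_trans[OF ip_bound], rule mult_mono)
        (auto simp: sum_nrm_def split_beta nrm_nonneg le_max_iff_disj)
    moreover have "absv (ip (snd x) (snd y)) \<le> sum_nrm nrm x * sum_nrm nrm y"
      by (rule order_trans[OF ip_bound], rule mult_mono)
        (auto simp: sum_nrm_def split_beta nrm_nonneg le_max_iff_disj)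
    ultimately show "absv (sum_ip ip x y) \<le> sum_nrm nrm x * sum_nrm nrm y"
      using absv_ultrametric[of "ip (fst x) (fst y)" "ip (snd x) (snd y)"]
      by (simp add: sum_ip_def split_beta)
  qed (simp_all add: absv_complete)
qed

end

theory Submission
  imports Defs
begin

text \<open>
  The adjoint of an operator matrix is the transposed matrix of the adjoints, so
  $U^* = \left(\begin{smallmatrix} T^* & M_T \cr M_{T^*} & -T \end{smallmatrix}\right)$.
  The diagonal entries of $U^*U$ and $UU^*$ are $I$ by the equations for the squares; the off-diagonal
  entries vanish by $T M_T = M_{T^*} T$ and its adjoint $M_T T^* = T^* M_{T^*}$.
\<close>

lemma op_matrix_apply [simp]: "op_matrix A B C D (x, y) = (A x + B y, C x + D y)"
  by (simp add: op_matrix_def)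

text \<open>The constant in \<open>bounded_operator\<close> carries no sign condition: on the zero
  space it may be negative. Passing to \<open>max C 0\<close> makes it fit for monotonicity of
  products.\<close>

lemma (in nonarch_normed_space) bounded_operator_bound:
  assumes "bounded_operator scl nrm T"
  obtains K where "0 \<le> K" "\<And>x. nrm (T x) \<le> K * nrm x"
proof -
  obtain C where C: "\<And>x. nrm (T x) \<le> C * nrm x"
    using assms by (auto simp: bounded_operator_def)
  have "nrm (T x) \<le> max C 0 * nrm x" for x
    using C[of x] nrm_nonneg[of x] by (meson max.cobounded1 mult_right_mono order_trans)
  then show thesis
    using that[of "max C 0"] by simp
qed

lemma bounded_operator_add:
  assumes "bounded_operator scl nrm T"
  shows "T (x + y) = T x + T y"
proof -
  interpret Vector_Spaces.linear scl scl T
    using assms by (simp add: bounded_operator_def)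
  show ?thesis by (rule add)
qed

lemma bounded_operator_scale:
  assumes "bounded_operator scl nrm T"
  shows "T (scl a x) = scl a (T x)"
proof -
  interpret Vector_Spaces.linear scl scl T
    using assms by (simp add: bounded_operator_def)
  show ?thesis by (rule scale)
qed

lemma bounded_operator_0:
  assumes "bounded_operator scl nrm T"
  shows "T 0 = 0"
  using bounded_operator_add[OF assms, of 0 0] by simp

lemma bounded_operator_diff:
  assumes "bounded_operator scl nrm T"
  shows "T (x - y) = T x - T y"
  using bounded_operator_add[OF assms, of "x - y" y] by (simp add: eq_diff_eq)

context nonarch_normed_space
begin

text \<open>Placed in \<open>nonarch_normed_space\<close> so that it serves both the given space
  and, through the interpretation \<open>s\<close>, the direct sum.\<close>

lemma bounded_operatorI:
  assumes "\<And>x y. T (x + y) = T x + T y"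
    and "\<And>a x. T (scl a x) = scl a (T x)"
    and "\<And>x. nrm (T x) \<le> C * nrm x"
  shows "bounded_operator scl nrm T"
proof -
  have "Vector_Spaces.linear scl scl T"
    by unfold_locales (simp_all add: assms)
  then show ?thesis
    using assms(3) by (auto simp: bounded_operator_def)
qed

lemma bounded_operator_comp:
  assumes S: "bounded_operator scl nrm S" and T: "bounded_operator scl nrm T"
  shows "bounded_operator scl nrm (S \<circ> T)"
proof -
  obtain K L where K: "0 \<le> K" "\<And>x. nrm (S x) \<le> K * nrm x" and L: "\<And>x. nrm (T x) \<le> L * nrm x"
    using bounded_operator_bound[OF S] bounded_operator_bound[OF T] by metis
  show ?thesis
  proof (rule bounded_operatorI)
    show "nrm ((S \<circ> T) x) \<le> (K * L) * nrm x" for x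
      using K(2)[of "T x"] mult_left_mono[OF L[of x] K(1)] by (simp add: mult.assoc)
  qed (simp_all add: bounded_operator_add[OF S] bounded_operator_add[OF T]
      bounded_operator_scale[OF S] bounded_operator_scale[OF T])
qed

lemma bounded_operator_uminus:
  assumes T: "bounded_operator scl nrm T"
  shows "bounded_operator scl nrm (\<lambda>x. - T x)"
proof -
  obtain K where "\<And>x. nrm (T x) \<le> K * nrm x"
    using bounded_operator_bound[OF T] by metis
  then show ?thesis
    by (intro bounded_operatorI[where C = K])
      (simp_all add: bounded_operator_add[OF T] bounded_operator_scale[OF T] nrm_minus)
qed

end

context padic_hilbert_space
begin

lemma ip_add_left: "ip (x + y) z = ip x z + ip y z"
  using ip_linear[of 1 x y z] by simp

lemma ip_add_right: "ip x (y + z) = ip x y + ip x z"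
  using ip_add_left[of y z x] by (simp add: ip_commute)

lemma ip_minus_left: "ip (- x) y = - ip x y"
  \<comment> \<open>With \<open>a = - 1\<close> linearity gives
    \<open>ip 0 y = - ip x y + ip x y = 0\<close>; additivity applied to \<open>- x + x\<close> then
    isolates \<open>ip (- x) y\<close>.\<close>
  using ip_linear[of "- 1" x x y] ip_add_left[of "-x" x y] by (simp add: eq_neg_iff_add_eq_0)

lemma ip_minus_right: "ip x (- y) = - ip x y"
  using ip_minus_left[of y x] by (simp add: ip_commute)

lemma is_adjoint_adjoint_op:
  assumes "adjointable scl nrm ip T"
  shows "is_adjoint scl nrm ip T (adjoint_op scl nrm ip T)"
  using assms adjoint_op_eq by (auto simp: adjointable_def)

text \<open>The form is symmetric, so adjointness is a symmetric relation. Boundedness of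
  \<open>T\<close> is a separate premise since \<open>is_adjoint\<close> records it only for the
  second operator.\<close>

lemma is_adjoint_sym:
  assumes "bounded_operator scl nrm T" "is_adjoint scl nrm ip T S"
  shows "is_adjoint scl nrm ip S T"
  using assms ip_commute unfolding is_adjoint_def by metis

lemma is_adjoint_comp:
  assumes "is_adjoint scl nrm ip S S'" "is_adjoint scl nrm ip T T'"
  shows "is_adjoint scl nrm ip (S \<circ> T) (T' \<circ> S')"
  using assms by (simp add: is_adjoint_def bounded_operator_comp)

lemma is_adjoint_uminus:
  assumes "is_adjoint scl nrm ip T S"
  shows "is_adjoint scl nrm ip (\<lambda>x. - T x) (\<lambda>x. - S x)"
  using assms by (simp add: is_adjoint_def bounded_operator_uminus ip_minus_left ip_minus_right)

lemma bounded_operator_op_matrix: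
  assumes A: "bounded_operator scl nrm A" and B: "bounded_operator scl nrm B"
    and C: "bounded_operator scl nrm C" and D: "bounded_operator scl nrm D"
  shows "bounded_operator (sum_scale scl) (sum_nrm nrm) (op_matrix A B C D)"
proof -
  interpret vp: vector_space_prod scl scl ..
  interpret s: padic_hilbert_space absv "sum_scale scl" "sum_nrm nrm" "sum_ip ip"
    by (rule direct_sum)
  note add = bounded_operator_add[OF A] bounded_operator_add[OF B]
    bounded_operator_add[OF C] bounded_operator_add[OF D]
  note scale = bounded_operator_scale[OF A] bounded_operator_scale[OF B]
    bounded_operator_scale[OF C] bounded_operator_scale[OF D]
  \<comment> \<open>The ultrametric inequality bounds each row by the larger of its two terms, so
    \<open>max p q\<close> is a constant for the row.\<close>
  have row: "\<exists>K. \<forall>x y. nrm (P x + Q y) \<le> K * sum_nrm nrm (x, y)"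
    if P: "bounded_operator scl nrm P" and Q: "bounded_operator scl nrm Q" for P Q
  proof -
    obtain p where p: "0 \<le> p" "\<And>x. nrm (P x) \<le> p * nrm x"
      using bounded_operator_bound[OF P] by metis
    obtain q where q: "0 \<le> q" "\<And>x. nrm (Q x) \<le> q * nrm x"
      using bounded_operator_bound[OF Q] by metis
    have "nrm (P x + Q y) \<le> max p q * sum_nrm nrm (x, y)" for x y
    proof -
      have "nrm (P x) \<le> max p q * sum_nrm nrm (x, y)"
        by (rule order_trans[OF p(2)], rule mult_mono)
          (use p q in \<open>auto simp: sum_nrm_def nrm_nonneg\<close>)
      moreover have "nrm (Q y) \<le> max p q * sum_nrm nrm (x, y)"
        by (rule order_trans[OF q(2)], rule mult_mono)
          (use p q in \<open>auto simp: sum_nrm_def nrm_nonneg\<close>)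
      ultimately show ?thesis
        using nrm_ultrametric[of "P x" "Q y"] by linarith
    qed
    then show ?thesis by blast
  qed
  obtain K L where K: "\<And>x y. nrm (A x + B y) \<le> K * sum_nrm nrm (x, y)"
    and L: "\<And>x y. nrm (C x + D y) \<le> L * sum_nrm nrm (x, y)"
    using row[OF A B] row[OF C D] by blast
  show ?thesis
  proof (rule s.bounded_operatorI)
    fix a and z w :: "'x \<times> 'x"
    obtain x y x' y' where z: "z = (x, y)" and w: "w = (x', y')"
      by (cases z, cases w)
    show "op_matrix A B C D (z + w) = op_matrix A B C D z + op_matrix A B C D w"
      by (simp add: z w add ac_simps)
    show "op_matrix A B C D (sum_scale scl a z) = sum_scale scl a (op_matrix A B C D z)"
      by (simp add: z vp.scale_def scale scale_right_distrib)
    \<comment> \<open>The sum norm is the maximum over the two rows; \<open>max K L\<close> bounds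
      both at once.\<close>
    have "nrm (A x + B y) \<le> max K L * sum_nrm nrm z" "nrm (C x + D y) \<le> max K L * sum_nrm nrm z"
      using K[of x y] L[of x y] s.nrm_nonneg[of z] unfolding z
      by (meson max.cobounded1 max.cobounded2 mult_right_mono order_trans)+
    then show "sum_nrm nrm (op_matrix A B C D z) \<le> max K L * sum_nrm nrm z"
      by (simp add: z sum_nrm_def[of nrm])
  qed
qed

text \<open>Expand \<open>ip (A x + B y) x' + ip (C x + D y) y'\<close> and regroup:
  \<open>x\<close> is paired with \<open>A' x' + C' y'\<close> and \<open>y\<close> with
  \<open>B' x' + D' y'\<close>.\<close>

lemma is_adjoint_op_matrix:
  assumes "is_adjoint scl nrm ip A A'" "is_adjoint scl nrm ip B B'"
    and "is_adjoint scl nrm ip C C'" "is_adjoint scl nrm ip D D'"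
  shows "is_adjoint (sum_scale scl) (sum_nrm nrm) (sum_ip ip)
    (op_matrix A B C D) (op_matrix A' C' B' D')"
  using assms
  by (auto simp: is_adjoint_def bounded_operator_op_matrix sum_ip_def ip_add_left ip_add_right)

end

theorem theorem2p5:
  fixes absv :: "'k::field \<Rightarrow> real"
    and scl :: "'k \<Rightarrow> 'x::ab_group_add \<Rightarrow> 'x"
    and nrm :: "'x \<Rightarrow> real"
    and ip :: "'x \<Rightarrow> 'x \<Rightarrow> 'k"
    and T M_T M_Tstar Tstar :: "'x \<Rightarrow> 'x"
    and U Ustar :: "'x \<times> 'x \<Rightarrow> 'x \<times> 'x"
  assumes "padic_hilbert_space absv scl nrm ip"
    and "magic_contraction scl nrm ip T"
    and "magic_operators scl nrm ip T M_T M_Tstar"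
  defines "Tstar \<equiv> adjoint_op scl nrm ip T"
    and "U \<equiv> op_matrix T M_Tstar M_T (\<lambda>x. - Tstar x)"
    and "Ustar \<equiv> adjoint_op (sum_scale scl) (sum_nrm nrm) (sum_ip ip) U"
  shows "unitary (sum_scale scl) (sum_nrm nrm) (sum_ip ip) U
    \<and> T = fst \<circ> U \<circ> (\<lambda>x. (x, 0))
    \<and> Tstar = fst \<circ> Ustar \<circ> (\<lambda>x. (x, 0))"
proof -
  interpret padic_hilbert_space absv scl nrm ip by fact
  interpret s: padic_hilbert_space absv "sum_scale scl" "sum_nrm nrm" "sum_ip ip"
    by (rule direct_sum)
  have bT: "bounded_operator scl nrm T" and T: "is_adjoint scl nrm ip T Tstar"
    using assms(2) is_adjoint_adjoint_op
    by (auto simp: magic_contraction_def adjointable_def Tstar_def)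
  have self: "is_adjoint scl nrm ip M_T M_T" "is_adjoint scl nrm ip M_Tstar M_Tstar"
    using assms(3) is_adjoint_adjoint_op unfolding magic_operators_def self_adjoint_def by metis+
  have MM: "M_T (M_T x) = x - Tstar (T x)" and NN: "M_Tstar (M_Tstar x) = x - T (Tstar x)"
    and TM: "T (M_T x) = M_Tstar (T x)" for x
    using assms(3) by (simp_all add: magic_operators_def Tstar_def fun_eq_iff)
  have "T \<circ> M_T = M_Tstar \<circ> T"
    using TM by auto
  \<comment> \<open>Composition reverses under adjoints, so the two sides are adjoints of
    \<open>T \<circ> M_T\<close> and \<open>M_Tstar \<circ> T\<close>. These are the same operator,
    and adjoints are unique.\<close>
  then have "M_T \<circ> Tstar = Tstar \<circ> M_Tstar"
    using is_adjoint_comp[OF T self(1)] is_adjoint_comp[OF self(2) T] adjoint_op_eq by metis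
  then have MT: "M_T (Tstar x) = Tstar (M_Tstar x)" for x
    by (simp add: fun_eq_iff)
  have b: "bounded_operator scl nrm M_T" "bounded_operator scl nrm M_Tstar"
    "bounded_operator scl nrm Tstar"
    using self T by (simp_all add: is_adjoint_def)
  note op_simps = bounded_operator_add[OF bT] b[THEN bounded_operator_add]
    bounded_operator_diff[OF bT] b[THEN bounded_operator_diff]
    bounded_operator_0[OF bT] b[THEN bounded_operator_0]
  have adj: "is_adjoint (sum_scale scl) (sum_nrm nrm) (sum_ip ip) U
      (op_matrix Tstar M_T M_Tstar (\<lambda>x. - T x))"
    unfolding U_def
    by (intro is_adjoint_op_matrix is_adjoint_uminus is_adjoint_sym[OF bT] T self)
  then have Ustar: "Ustar = op_matrix Tstar M_T M_Tstar (\<lambda>x. - T x)"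
    unfolding Ustar_def by (rule s.adjoint_op_eq)
  \<comment> \<open>\<open>adj\<close> supplies boundedness of the adjoint only; adjointability also
    asks for that of \<open>U\<close>.\<close>
  have "bounded_operator (sum_scale scl) (sum_nrm nrm) U"
    unfolding U_def by (intro bounded_operator_op_matrix bounded_operator_uminus bT b)
  with adj have "adjointable (sum_scale scl) (sum_nrm nrm) (sum_ip ip) U"
    by (auto simp: adjointable_def)
  \<comment> \<open>Up to sign, each product has both \<open>T M_T - M_Tstar T\<close> and
    \<open>M_T Tstar - Tstar M_Tstar\<close> off the diagonal, so each uses both \<open>TM\<close>
    and \<open>MT\<close>.\<close>
  moreover have "U \<circ> Ustar = id" "Ustar \<circ> U = id"
    by (auto simp: fun_eq_iff Ustar U_def op_simps MM NN TM MT)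
  \<comment> \<open>On \<open>(x, 0)\<close> the second columns contribute
    \<open>M_Tstar 0 = 0\<close> and \<open>M_T 0 = 0\<close> to the first components of
    \<open>U\<close> and \<open>Ustar\<close>, which leaves \<open>T x\<close> and
    \<open>Tstar x\<close>.\<close>
  ultimately show ?thesis
    unfolding unitary_def Ustar_def[symmetric]
    by (auto simp: fun_eq_iff Ustar U_def op_simps)
qed

end
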